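(* Let $n \ge 1$ be an integer such that $2n+1$ is a prime, and let $S$ be a perfect dominating set of the graph $C_{2n+1}^n$ (the Cartesian product of $n$ copies of the cycle of length $2n+1$). Identify the vertices of $C_{2n+1}^n$ with $\mathbb{Z}_{2n+1}^n$, where $x \sim y$ if and only if $x - y = \pm e_i$ for some $i \in \{1,\ldots,n\}$ ($e_i$ the $i$-th unit vector). Then for every $(x_1,\ldots,x_n) \in \mathbb{Z}_{2n+1}^n$ and every $i \in \{1,\ldots,n\}$, $$\left| S \cap \{(y_1,\ldots,y_n) \in \mathbb{Z}_{2n+1}^n : y_j = x_j \text{ for all } j \neq i\}\right| = 1.$$
   Context: A vertex $u$ dominates a vertex $v$ if $u = v$ or $u$ is adjacent to $v$. A set $S$ of vertices is a dominating set if every vertex is dominated by at least one vertex of $S$; it is a perfect dominating set if moreover every vertex is dominated by exactly one vertex of $S$. The Cartesian product of graphs $G$ and $H$ has vertex set $V(G)\times V(H)$, with $(x,y)\sim(x',y')$ iff ($x=x'$ and $y\sim y'$) or ($x\sim x'$ and $y=y'$). *)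

theory Defs
  imports "HOL-Number_Theory.Cong" "HOL-Library.FuncSet"
begin

text \<open>A graph is given by a vertex set \<open>V\<close> and an adjacency relation \<open>adj\<close>.\<close>

definition dominates :: "('a \<Rightarrow> 'a \<Rightarrow> bool) \<Rightarrow> 'a \<Rightarrow> 'a \<Rightarrow> bool" where
  "dominates adj u v \<longleftrightarrow> u = v \<or> adj u v"

definition dominating_set :: "'a set \<Rightarrow> ('a \<Rightarrow> 'a \<Rightarrow> bool) \<Rightarrow> 'a set \<Rightarrow> bool" where
  "dominating_set V adj S \<longleftrightarrow> S \<subseteq> V \<and> (\<forall>v\<in>V. \<exists>u\<in>S. dominates adj u v)"

definition perfect_dominating_set :: "'a set \<Rightarrow> ('a \<Rightarrow> 'a \<Rightarrow> bool) \<Rightarrow> 'a set \<Rightarrow> bool" where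
  "perfect_dominating_set V adj S \<longleftrightarrow>
     dominating_set V adj S \<and> (\<forall>v\<in>V. \<exists>!u. u \<in> S \<and> dominates adj u v)"

text \<open>Elements of \<open>\<int>\<^sub>m\<^sup>n\<close> are functions on \<open>{1..n}\<close> (\<open>undefined\<close> elsewhere) with values in the
  residues \<open>{0..<m}\<close>; the vector equations \<open>x - y = \<plusminus>e\<^sub>i\<close> are read coordinatewise modulo \<open>m\<close>.\<close>

definition Zvec :: "nat \<Rightarrow> nat \<Rightarrow> (nat \<Rightarrow> int) set" where
  "Zvec m n = {1..n} \<rightarrow>\<^sub>E {0..<int m}"

definition unit_vector :: "nat \<Rightarrow> nat \<Rightarrow> int" where
  "unit_vector i j = (if j = i then 1 else 0)"

definition cycle_power_adj :: "nat \<Rightarrow> nat \<Rightarrow> (nat \<Rightarrow> int) \<Rightarrow> (nat \<Rightarrow> int) \<Rightarrow> bool" where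
  "cycle_power_adj m n x y \<longleftrightarrow>
     (\<exists>i\<in>{1..n}. (\<forall>j\<in>{1..n}. [x j - y j = unit_vector i j] (mod int m)) \<or>
                 (\<forall>j\<in>{1..n}. [x j - y j = - unit_vector i j] (mod int m)))"

text \<open>The following facts justify the identification: up to isomorphism, the graph on
  \<open>Zvec m n\<close> is the iterated Cartesian product of \<open>n\<close> cycles of length \<open>m\<close>.\<close>

definition cycle_adj :: "nat \<Rightarrow> int \<Rightarrow> int \<Rightarrow> bool" where
  "cycle_adj m a b \<longleftrightarrow> [a - b = 1] (mod int m) \<or> [a - b = -1] (mod int m)"

definition cartesian_adj ::
  "('a \<Rightarrow> 'a \<Rightarrow> bool) \<Rightarrow> ('b \<Rightarrow> 'b \<Rightarrow> bool) \<Rightarrow> 'a \<times> 'b \<Rightarrow> 'a \<times> 'b \<Rightarrow> bool" where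
  "cartesian_adj adjG adjH p q \<longleftrightarrow>
     (fst p = fst q \<and> adjH (snd p) (snd q)) \<or> (adjG (fst p) (fst q) \<and> snd p = snd q)"

lemma Zvec_cong_0_iff:
  assumes "x \<in> Zvec m n" "y \<in> Zvec m n" "j \<in> {1..n}"
  shows "[x j - y j = 0] (mod int m) \<longleftrightarrow> x j = y j"
proof -
  have "x j \<in> {0..<int m}" "y j \<in> {0..<int m}"
    using assms unfolding Zvec_def by (blast dest: PiE_mem)+
  then show ?thesis
    by (simp add: cong_iff_dvd_diff mod_eq_dvd_iff[symmetric])
qed

lemma cycle_power_adj_iff:
  assumes "x \<in> Zvec m n" "y \<in> Zvec m n"
  shows "cycle_power_adj m n x y \<longleftrightarrow>
    (\<exists>i\<in>{1..n}. cycle_adj m (x i) (y i) \<and> (\<forall>j\<in>{1..n} - {i}. x j = y j))"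
proof -
  have "(\<forall>j\<in>{1..n}. [x j - y j = unit_vector i j] (mod int m)) \<longleftrightarrow>
          [x i - y i = 1] (mod int m) \<and> (\<forall>j\<in>{1..n} - {i}. x j = y j)"
       "(\<forall>j\<in>{1..n}. [x j - y j = - unit_vector i j] (mod int m)) \<longleftrightarrow>
          [x i - y i = -1] (mod int m) \<and> (\<forall>j\<in>{1..n} - {i}. x j = y j)"
    if "i \<in> {1..n}" for i
    using that Zvec_cong_0_iff[OF assms] unfolding unit_vector_def by force+
  then show ?thesis
    unfolding cycle_power_adj_def cycle_adj_def by blast
qed

lemma Zvec_1_bij: "bij_betw (\<lambda>x. x 1) (Zvec m 1) {0..<int m}"
  by (rule bij_betw_byWitness[where f' = "\<lambda>a. restrict (\<lambda>_. a) {1}"])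
     (auto simp: Zvec_def PiE_iff extensional_def fun_eq_iff split: if_splits)

lemma cycle_power_adj_1: "cycle_power_adj m 1 x y \<longleftrightarrow> cycle_adj m (x 1) (y 1)"
  by (simp add: cycle_power_adj_def cycle_adj_def unit_vector_def)

lemma Zvec_Suc_bij:
  "bij_betw (\<lambda>x. (restrict x {1..n}, x (Suc n))) (Zvec m (Suc n)) (Zvec m n \<times> {0..<int m})"
  by (rule bij_betw_byWitness[where f' = "\<lambda>(x, a). x(Suc n := a)"])
     (auto simp: Zvec_def PiE_iff extensional_def fun_eq_iff restrict_def atLeastAtMostSuc_conv
        split: if_splits)

lemma cycle_power_adj_Suc:
  assumes "x \<in> Zvec m (Suc n)" "y \<in> Zvec m (Suc n)"
  shows "cycle_power_adj m (Suc n) x y \<longleftrightarrow>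
    cartesian_adj (cycle_power_adj m n) (cycle_adj m)
      (restrict x {1..n}, x (Suc n)) (restrict y {1..n}, y (Suc n))"
proof -
  have r: "restrict x {1..n} \<in> Zvec m n" "restrict y {1..n} \<in> Zvec m n"
    using assms unfolding Zvec_def by (auto simp: PiE_iff)
  have e: "restrict x {1..n} = restrict y {1..n} \<longleftrightarrow> (\<forall>j\<in>{1..n}. x j = y j)"
    by (auto simp: restrict_def fun_eq_iff)
  have s: "{1..Suc n} = insert (Suc n) {1..n}" by auto
  have n: "Suc n \<notin> {1..n}" by simp
  have "cycle_power_adj m (Suc n) x y \<longleftrightarrow>
      (cycle_adj m (x (Suc n)) (y (Suc n)) \<and> (\<forall>j\<in>{1..n}. x j = y j)) \<or>
      (\<exists>i\<in>{1..n}. cycle_adj m (x i) (y i) \<and> x (Suc n) = y (Suc n) \<and>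
         (\<forall>j\<in>{1..n} - {i}. x j = y j))"
    unfolding cycle_power_adj_iff[OF assms] s using n by blast
  moreover have "cycle_power_adj m n (restrict x {1..n}) (restrict y {1..n}) \<longleftrightarrow>
      (\<exists>i\<in>{1..n}. cycle_adj m (x i) (y i) \<and> (\<forall>j\<in>{1..n} - {i}. x j = y j))"
    unfolding cycle_power_adj_iff[OF r] by simp
  ultimately show ?thesis
    unfolding cartesian_adj_def fst_conv snd_conv e by metis
qed

end

theory Submission
  imports Defs "HOL-Library.Function_Algebras"
begin

text \<open>
  Put \<open>p = 2n + 1\<close> and \<open>A = {0, \<plusminus>e\<^sub>1, \<dots>, \<plusminus>e\<^sub>n}\<close>, so that \<open>|A| = p\<close> and the translates of
  \<open>S\<close> by \<open>A\<close> tile \<open>\<int>\<^sub>p\<^sup>n\<close>. If \<open>q \<noteq> p\<close> is prime, then the translates of \<open>S\<close> by \<open>qA\<close> still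
  tile: for fixed \<open>g\<close> there are \<open>p\<^bsup>q-1\<^esup>\<close> tuples \<open>(a\<^sub>1, \<dots>, a\<^sub>q)\<close> with
  \<open>g - a\<^sub>1 - \<dots> - a\<^sub>q \<in> S\<close>, and cyclic rotation acts on them, so, as \<open>q\<close> does not divide their
  number, some constant tuple is among them; hence \<open>qA + S\<close> covers everything, and by counting
  it covers exactly once. Iterating, \<open>tA + S\<close> tiles for every \<open>t\<close> prime to \<open>p\<close>. Two distinct points
  of \<open>S\<close> on a line in direction \<open>e\<^sub>i\<close> differ by some \<open>t e\<^sub>i\<close>, which contradicts that \<open>tA + S\<close>
  is a tiling. So each such line contains at most one point of \<open>S\<close>, and by counting exactly one.
\<close>

section \<open>Orbits of a map of prime period\<close>

text \<open>The orbits of \<open>f\<close> partition \<open>X\<close>, and an orbit with fewer than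
  \<open>q\<close> elements would be a fixed point because \<open>q\<close> is prime.\<close>

lemma prime_dvd_card_if_fixpoint_free:
  fixes f :: "'a \<Rightarrow> 'a" and q :: nat
  assumes fin: "finite X" and q: "prime q"
    and closed: "\<And>x. x \<in> X \<Longrightarrow> f x \<in> X"
    and period: "\<And>x. x \<in> X \<Longrightarrow> (f ^^ q) x = x"
    and free: "\<And>x. x \<in> X \<Longrightarrow> f x \<noteq> x"
  shows "q dvd card X"
proof -
  have q0: "q > 0" using q by (simp add: prime_gt_0_nat)
  have closed': "(f ^^ k) x \<in> X" if "x \<in> X" for k x
    using that by (induction k) (auto intro: closed)
  have period': "(f ^^ (d * m)) x = x" if "(f ^^ d) x = x" for d m x
    using that by (induction m) (auto simp: funpow_add)
  have modq: "(f ^^ k) x = (f ^^ (k mod q)) x" if "x \<in> X" for k x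
  proof -
    have "(f ^^ (k mod q + q * (k div q))) x = (f ^^ (k mod q)) x"
      unfolding funpow_add using period'[OF period[OF that]] by simp
    then show ?thesis unfolding mod_mult_div_eq .
  qed
  define r where "r = {(x, y). x \<in> X \<and> (\<exists>k. y = (f ^^ k) x)}"
  have eq: "equiv X r"
  proof (rule equivI)
    show "r \<subseteq> X \<times> X" by (auto simp: r_def closed')
    show "refl_on X r" by (auto simp: refl_on_def r_def intro: exI[of _ 0])
    show "trans r"
    proof (rule transI)
      fix x y z assume "(x, y) \<in> r" "(y, z) \<in> r"
      then obtain k l where "x \<in> X" "y = (f ^^ k) x" "z = (f ^^ l) y" by (auto simp: r_def)
      then have "x \<in> X" "z = (f ^^ (l + k)) x" by (simp_all add: funpow_add)
      then show "(x, z) \<in> r" unfolding r_def by blast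
    qed
    show "sym r"
    proof (rule symI)
      fix x y assume "(x, y) \<in> r"
      then obtain k where k: "x \<in> X" "y = (f ^^ k) x" by (auto simp: r_def)
      then have "(f ^^ (q - k mod q)) y = (f ^^ (q - k mod q)) ((f ^^ (k mod q)) x)"
        using modq[OF k(1), of k] by simp
      also have "\<dots> = (f ^^ (q - k mod q + k mod q)) x" by (simp add: funpow_add)
      also have "\<dots> = x" using period[OF k(1)] q0 by simp
      finally have "x = (f ^^ (q - k mod q)) y" by simp
      moreover have "y \<in> X" using k closed' by simp
      ultimately show "(y, x) \<in> r" by (auto simp: r_def)
    qed
  qed
  have orbit: "q dvd card C" if "C \<in> X // r" for C
  proof -
    obtain x where x: "x \<in> X" "C = r `` {x}" using \<open>C \<in> X // r\<close> by (auto simp: quotient_def)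
    have C: "C = (\<lambda>k. (f ^^ k) x) ` {..<q}"
    proof
      show "C \<subseteq> (\<lambda>k. (f ^^ k) x) ` {..<q}"
      proof
        fix y assume "y \<in> C"
        then obtain k where "y = (f ^^ k) x" using x by (auto simp: r_def)
        then have "y = (f ^^ (k mod q)) x" using modq[OF x(1)] by simp
        then show "y \<in> (\<lambda>k. (f ^^ k) x) ` {..<q}" using q0 by auto
      qed
      show "(\<lambda>k. (f ^^ k) x) ` {..<q} \<subseteq> C" using x by (auto simp: r_def)
    qed
    have neq: "(f ^^ i) x \<noteq> (f ^^ j) x" if ij: "i < j" "j < q" for i j
    proof
      assume e: "(f ^^ i) x = (f ^^ j) x"
      define y where "y = (f ^^ i) x"
      have y: "y \<in> X" using x closed' by (simp add: y_def)
      have "(f ^^ (j - i)) y = (f ^^ (j - i + i)) x" by (simp add: y_def funpow_add)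
      also have "\<dots> = y" using e ij by (simp add: y_def)
      finally have d: "(f ^^ (j - i)) y = y" .
      have "coprime (j - i) q"
        using q ij by (metis coprime_commute dvd_imp_le less_imp_diff_less linorder_not_less
            prime_imp_coprime zero_less_diff)
      \<comment> \<open>With \<open>m\<close> inverse to \<open>j - i\<close> modulo
        \<open>q\<close>, the power \<open>f ^^ ((j - i) * m)\<close> fixes \<open>y\<close> and
        also acts on it as \<open>f\<close> itself.\<close>
      then obtain m where "[(j - i) * m = 1] (mod q)" using cong_solve_coprime_nat by auto
      then have "((j - i) * m) mod q = 1"
        using prime_gt_1_nat[OF q] by (simp add: cong_def)
      then have "y = f y" using period'[OF d, of m] modq[OF y, of "(j - i) * m"] by simp
      then show False using free[OF y] by simp
    qed
    have "inj_on (\<lambda>k. (f ^^ k) x) {..<q}"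
      by (intro linorder_inj_onI) (use neq in auto)
    then show ?thesis by (simp add: C card_image)
  qed
  show ?thesis by (rule equiv_imp_dvd_card[OF fin eq orbit])
qed

section \<open>Tilings of a group by translates\<close>

text \<open>An indexed family instead of a set of translations: multiplying it by \<open>t\<close>
  leaves \<open>J\<close> and its cardinality unchanged, even if values coincide.\<close>

definition tiles :: "'j set \<Rightarrow> ('j \<Rightarrow> 'a::group_add) \<Rightarrow> 'a set \<Rightarrow> bool" where
  "tiles J a S \<longleftrightarrow> (\<forall>g. \<exists>!j. j \<in> J \<and> g - a j \<in> S)"

lemma card_eq_1_iff_Ex1: "card {j \<in> J. P j} = 1 \<longleftrightarrow> (\<exists>!j. j \<in> J \<and> P j)"
  by (simp add: card_1_singleton_iff Ex1_def set_eq_iff) blast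

lemma tiles_iff_card: "tiles J a S \<longleftrightarrow> (\<forall>g. card {j \<in> J. g - a j \<in> S} = 1)"
  unfolding tiles_def card_eq_1_iff_Ex1 ..

text \<open>The last \<open>k\<close> entries are free and determine the first one, by the tiling
  property at \<open>g\<close> minus their sum.\<close>

lemma card_tuples_tiles:
  fixes a :: "'j \<Rightarrow> 'a::ab_group_add"
  assumes fin: "finite J" and tile: "tiles J a S"
  shows "card {xs. set xs \<subseteq> J \<and> length xs = Suc k \<and> g - sum_list (map a xs) \<in> S} = card J ^ k"
    (is "card ?X = _")
proof -
  have "bij_betw tl ?X {ys. set ys \<subseteq> J \<and> length ys = k}"
    unfolding bij_betw_def
  proof
    show "inj_on tl ?X"
    proof (rule inj_onI)
      fix xs ys assume A: "xs \<in> ?X" "ys \<in> ?X" "tl xs = tl ys"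
      obtain i j zs where ij: "xs = i # zs" "ys = j # zs"
        using A by (cases xs; cases ys) auto
      then have "i \<in> J" "j \<in> J" "(g - sum_list (map a zs)) - a i \<in> S"
        "(g - sum_list (map a zs)) - a j \<in> S"
        using A by (auto simp: algebra_simps)
      then have "i = j" using tile unfolding tiles_def by blast
      then show "xs = ys" using ij by simp
    qed
    show "tl ` ?X = {ys. set ys \<subseteq> J \<and> length ys = k}"
    proof
      show "tl ` ?X \<subseteq> {ys. set ys \<subseteq> J \<and> length ys = k}"
        by (auto dest: list.set_sel(2)[rotated])
      show "{ys. set ys \<subseteq> J \<and> length ys = k} \<subseteq> tl ` ?X"
      proof
        fix ys assume ys: "ys \<in> {ys. set ys \<subseteq> J \<and> length ys = k}"
        obtain j where "j \<in> J" "(g - sum_list (map a ys)) - a j \<in> S"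
          using tile unfolding tiles_def by blast
        then have "j # ys \<in> ?X" using ys by (auto simp: algebra_simps)
        then show "ys \<in> tl ` ?X" by (rule image_eqI[rotated]) simp
      qed
    qed
  qed
  then have "card ?X = card {ys. set ys \<subseteq> J \<and> length ys = k}" by (rule bij_betw_same_card)
  then show ?thesis using card_lists_length_eq[OF fin] by simp
qed

text \<open>The ring structure only serves to write the \<open>q\<close>-fold sum \<open>x + \<dots> + x\<close> as \<open>of_nat q * x\<close>.\<close>

lemma tiles_mult_prime_covers:
  fixes a :: "'j \<Rightarrow> 'a::ring_1"
  assumes fin: "finite J" and tile: "tiles J a S" and q: "prime q" "\<not> q dvd card J"
  shows "\<exists>j\<in>J. g - of_nat q * a j \<in> S"
proof (rule ccontr)
  assume none: "\<not> ?thesis"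
  define X where "X = {xs. set xs \<subseteq> J \<and> length xs = q \<and> g - sum_list (map a xs) \<in> S}"
  have finX: "finite X"
    by (rule finite_subset[OF _ finite_lists_length_eq[OF fin, of q]]) (auto simp: X_def)
  have sum_rotate1: "sum_list (map a (rotate1 xs)) = sum_list (map a xs)" for xs
    by (cases xs) (auto simp: add.commute)
  have "q dvd card X"
  proof (rule prime_dvd_card_if_fixpoint_free[OF finX q(1), where f = rotate1])
    fix xs assume xs: "xs \<in> X"
    show "rotate1 xs \<in> X" using xs by (simp add: X_def sum_rotate1)
    show "(rotate1 ^^ q) xs = xs"
      using xs rotate_id[of q xs] by (simp add: X_def rotate_def)
    show "rotate1 xs \<noteq> xs"
    proof
      assume fixp: "rotate1 xs = xs"
      have len: "length xs = q" "q > 0" using xs q by (auto simp: X_def prime_gt_0_nat)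
      have "(rotate1 ^^ k) xs = xs" for k by (induction k) (simp_all add: fixp)
      \<comment> \<open>Rotation by \<open>k\<close> brings entry \<open>k\<close> to the head, so a
        list fixed by rotation is constant.\<close>
      then have "hd xs = xs ! k" if "k < q" for k
        using that len hd_rotate_conv_nth[of xs k] by (force simp: rotate_def)
      then have "xs = replicate q (hd xs)" using len by (intro nth_equalityI) auto
      then have "sum_list (map a xs) = of_nat q * a (hd xs)"
        by (metis map_replicate sum_list_replicate)
      moreover have "hd xs \<in> J" using xs len by (auto simp: X_def)
      ultimately show False using xs none by (auto simp: X_def)
    qed
  qed
  moreover have "card X = card J ^ (q - 1)"
    using card_tuples_tiles[OF fin tile, of "q - 1" g] prime_gt_0_nat[OF q(1)]
    by (simp add: X_def)
  ultimately show False using q prime_dvd_power by auto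
qed

section \<open>Double counting over representatives\<close>

text \<open>
  The set \<open>R\<close> plays the role of a finite system of representatives modulo the periods of \<open>S\<close>,
  each translate of \<open>S\<close> having \<open>c\<close> elements in it.
\<close>

locale constant_density =
  fixes R S :: "'a::ring_1 set" and c :: nat
  assumes finite_R: "finite R" and R_nonempty: "R \<noteq> {}"
    and density: "\<And>v. card {g \<in> R. g - v \<in> S} = c"
begin

text \<open>Pairs \<open>(g, j)\<close> are counted by \<open>j\<close> instead of by
  \<open>g\<close>. The shift \<open>w\<close> gives access to counts at points outside
  \<open>R\<close>.\<close>

lemma sum_card_translates:
  assumes "finite J"
  shows "(\<Sum>g\<in>R. card {j \<in> J. g + w - a j \<in> S}) = card J * c"
proof -
  have "(\<Sum>g\<in>R. card {j \<in> J. g + w - a j \<in> S}) = (\<Sum>j\<in>J. card {g \<in> R. g - (a j - w) \<in> S})"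
    using sum_multicount_gen[OF finite_R assms,
        of "\<lambda>g j. g + w - a j \<in> S" "\<lambda>j. card {g \<in> R. g - (a j - w) \<in> S}"]
    by (simp add: algebra_simps)
  then show ?thesis by (simp add: density)
qed

lemma card_R:
  assumes "finite J" and "tiles J a S"
  shows "card R = card J * c"
  using sum_card_translates[OF assms(1), of 0 a] assms(2) by (simp add: tiles_iff_card)

text \<open>The counts are at least 1 and sum to \<open>card R\<close> over each translate of
  \<open>R\<close>, so all of them equal 1.\<close>

lemma tiles_if_covers:
  assumes fin: "finite J" and card: "card J * c = card R"
    and covers: "\<And>g. \<exists>j\<in>J. g - a j \<in> S"
  shows "tiles J a S"
  unfolding tiles_iff_card
proof
  fix g
  obtain r where r: "r \<in> R" using R_nonempty by blast
  have ge: "1 \<le> card {j \<in> J. h - a j \<in> S}" for h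
    using covers[of h] fin by (auto simp: Suc_le_eq card_gt_0_iff)
  \<comment> \<open>The shift by \<open>g - r\<close> makes the count at \<open>g\<close> the
    summand at \<open>r\<close>.\<close>
  have "(\<Sum>h\<in>R. 1) = (\<Sum>h\<in>R. card {j \<in> J. h + (g - r) - a j \<in> S})"
    using sum_card_translates[OF fin] card by simp
  then have "1 = card {j \<in> J. r + (g - r) - a j \<in> S}"
    by (rule sum_mono_inv[OF _ _ r finite_R]) (rule ge)
  then show "card {j \<in> J. g - a j \<in> S} = 1" by simp
qed

lemma tiles_if_disjoint:
  assumes fin: "finite J" and card: "card J * c = card R"
    and disj: "\<And>g i j. i \<in> J \<Longrightarrow> j \<in> J \<Longrightarrow> g - a i \<in> S \<Longrightarrow> g - a j \<in> S \<Longrightarrow> i = j"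
  shows "tiles J a S"
  unfolding tiles_iff_card
proof
  fix g
  obtain r where r: "r \<in> R" using R_nonempty by blast
  have le: "card {j \<in> J. h - a j \<in> S} \<le> 1" for h
    using disj[of _ _ h] fin by (auto simp: card_le_Suc0_iff_eq)
  have "(\<Sum>h\<in>R. card {j \<in> J. h + (g - r) - a j \<in> S}) = (\<Sum>h\<in>R. 1)"
    using sum_card_translates[OF fin] card by simp
  then have "card {j \<in> J. r + (g - r) - a j \<in> S} = 1"
    by (rule sum_mono_inv[OF _ _ r finite_R]) (rule le)
  then show "card {j \<in> J. g - a j \<in> S} = 1" by simp
qed

text \<open>Prime factors of \<open>t\<close> are split off one at a time; each gives a covering,
  which counting turns into a tiling.\<close>

lemma tiles_mult_coprime:
  assumes fin: "finite J" and tile: "tiles J a S" and "coprime t (card J)" "t > 0"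
  shows "tiles J (\<lambda>j. of_nat t * a j) S"
  using assms(3,4)
proof (induction t rule: less_induct)
  case (less t)
  show ?case
  proof (cases "t = 1")
    case True
    then show ?thesis using tile by simp
  next
    case False
    then obtain q m where q: "prime q" "t = q * m"
      using prime_factor_nat[of t] by (auto elim: dvdE)
    have cop: "coprime q (card J)" "coprime m (card J)" using less.prems q by auto
    have "m > 0" using less.prems q by auto
    moreover have "m < t" using q \<open>m > 0\<close> prime_gt_1_nat[OF q(1)] by simp
    ultimately have m: "tiles J (\<lambda>j. of_nat m * a j) S" using less.IH cop by blast
    have "\<not> q dvd card J"
      using cop q by (metis coprime_absorb_left not_prime_unit)
    then have "\<exists>j\<in>J. g - of_nat t * a j \<in> S" for g
      using tiles_mult_prime_covers[OF fin m q(1)] q by (simp add: mult.assoc)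
    then show ?thesis by (intro tiles_if_covers fin card_R[OF fin tile, symmetric])
  qed
qed

text \<open>For \<open>k < l < card J\<close>, multiplying by \<open>l - k\<close> preserves the
  tiling since \<open>card J\<close> is prime; this forbids two hits on the line, and counting does
  the rest.\<close>

lemma tiles_line:
  assumes fin: "finite J" and tile: "tiles J a S" and p: "prime (card J)"
    and z: "z \<in> J" "a z = 0" and u: "u \<in> J" "u \<noteq> z"
  shows "tiles {..<card J} (\<lambda>k. of_nat k * a u) S"
proof -
  have neq: False
    if kl: "k < l" "l < card J" and S: "g - of_nat k * a u \<in> S" "g - of_nat l * a u \<in> S"
    for g k l
  proof -
    define h where "h = g - of_nat k * a u"
    have "coprime (l - k) (card J)"
      using p kl by (metis coprime_commute dvd_imp_le less_imp_diff_less linorder_not_less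
          prime_imp_coprime zero_less_diff)
    then have "tiles J (\<lambda>j. of_nat (l - k) * a j) S"
      using kl by (intro tiles_mult_coprime[OF fin tile]) simp_all
    \<comment> \<open>\<open>h\<close> is reached through \<open>z\<close>, as
      \<open>a z = 0\<close>, and through \<open>u\<close>, as one more jump by \<open>l - k\<close>
      leads to \<open>g - of_nat l * a u\<close>.\<close>
    moreover have "h - of_nat (l - k) * a z \<in> S" "h - of_nat (l - k) * a u \<in> S"
      using S kl z by (simp_all add: h_def algebra_simps)
    ultimately show False using z u unfolding tiles_def by blast
  qed
  show ?thesis
  proof (rule tiles_if_disjoint)
    show "k = l" if "k \<in> {..<card J}" "l \<in> {..<card J}"
      "g - of_nat k * a u \<in> S" "g - of_nat l * a u \<in> S" for g k l
      using neq[of k l g] neq[of l k g] that by (cases k l rule: linorder_cases) auto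
  qed (simp_all add: card_R[OF fin tile])
qed

end

section \<open>Integer vectors modulo m\<close>

text \<open>The tilings live in the ring of all functions from \<open>nat\<close> to
  \<open>int\<close>, where \<open>S\<close> is replaced by its preimage under this map, a periodic
  set.\<close>

definition reduce :: "nat \<Rightarrow> nat \<Rightarrow> (nat \<Rightarrow> int) \<Rightarrow> nat \<Rightarrow> int" where
  "reduce m n v = (\<lambda>j\<in>{1..n}. v j mod int m)"

lemma reduce_in_Zvec: "m > 0 \<Longrightarrow> reduce m n v \<in> Zvec m n"
  by (auto simp: reduce_def Zvec_def)

lemma reduce_eq_iff: "reduce m n v = reduce m n w \<longleftrightarrow> (\<forall>j\<in>{1..n}. [v j = w j] (mod int m))"
  by (auto simp: reduce_def restrict_def fun_eq_iff cong_def)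

lemma reduce_Zvec: "x \<in> Zvec m n \<Longrightarrow> reduce m n x = x"
  by (auto simp: reduce_def Zvec_def PiE_iff extensional_def restrict_def fun_eq_iff)

text \<open>Translation by \<open>v\<close> followed by reduction permutes
  \<open>Zvec m n\<close>.\<close>

lemma constant_density_Zvec:
  assumes "m > 0" and S: "S \<subseteq> Zvec m n"
  shows "constant_density (Zvec m n) {v. reduce m n v \<in> S} (card S)"
proof
  show "finite (Zvec m n)" unfolding Zvec_def by (intro finite_PiE) auto
  show "Zvec m n \<noteq> {}" using reduce_in_Zvec[OF assms(1)] by blast
  fix v :: "nat \<Rightarrow> int"
  have inv: "reduce m n (reduce m n (g - v) + v) = g"
    "reduce m n (reduce m n (g + v) - v) = g" if "g \<in> Zvec m n" for g
  proof -
    have "reduce m n (reduce m n (g - v) + v) = reduce m n g"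
      "reduce m n (reduce m n (g + v) - v) = reduce m n g"
      unfolding reduce_eq_iff by (simp_all add: reduce_def cong_def mod_simps)
    then show "reduce m n (reduce m n (g - v) + v) = g"
      "reduce m n (reduce m n (g + v) - v) = g"
      using reduce_Zvec[OF that] by simp_all
  qed
  have "bij_betw (\<lambda>g. reduce m n (g - v)) {g \<in> Zvec m n. g - v \<in> {v. reduce m n v \<in> S}} S"
    by (rule bij_betw_byWitness[where f' = "\<lambda>s. reduce m n (s + v)"])
       (use S inv reduce_in_Zvec[OF assms(1)] in auto)
  then show "card {g \<in> Zvec m n. g - v \<in> {v. reduce m n v \<in> S}} = card S"
    by (rule bij_betw_same_card)
qed

section \<open>Perfect domination as a tiling\<close>

text \<open>Enumerates \<open>0, \<plusminus>e\<^sub>1, \<dots>, \<plusminus>e\<^sub>n\<close> by the integers in \<open>{-n..n}\<close>.\<close>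

definition signed_unit :: "int \<Rightarrow> nat \<Rightarrow> int" where
  "signed_unit j = (\<lambda>i. if i = nat \<bar>j\<bar> then sgn j else 0)"

lemma signed_unit_simps:
  "signed_unit 0 = 0"
  "i > 0 \<Longrightarrow> signed_unit (int i) = unit_vector i"
  "i > 0 \<Longrightarrow> signed_unit (- int i) = - unit_vector i"
  by (auto simp: signed_unit_def unit_vector_def fun_eq_iff)

lemma signed_unit_cases:
  assumes "j \<in> {- int n..int n}"
  obtains "j = 0" | i where "i \<in> {1..n}" "j = int i" | i where "i \<in> {1..n}" "j = - int i"
proof -
  consider "j = 0" | "j > 0" | "j < 0" by linarith
  then show thesis
  proof cases
    case 2
    then show thesis using assms that(2)[of "nat j"] by auto
  next
    case 3
    then show thesis using assms that(3)[of "nat (- j)"] by auto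
  qed (use that in simp)
qed

text \<open>Coordinates lie in \<open>{-1, 0, 1}\<close> and differ by at most 2, so
  \<open>m \<ge> 3\<close> turns congruence into equality.\<close>

lemma signed_unit_cong_imp_eq:
  assumes m: "m \<ge> 3" and j: "j \<in> {- int n..int n}" and l: "l \<in> {- int n..int n}"
    and cong: "\<forall>i\<in>{1..n}. [signed_unit j i = signed_unit l i] (mod int m)"
  shows "j = l"
proof -
  have "signed_unit j i = signed_unit l i" if "i \<in> {1..n}" for i
  proof -
    have "\<bar>signed_unit j i - signed_unit l i\<bar> < int m"
      using m by (auto simp: signed_unit_def sgn_if)
    moreover have "int m dvd signed_unit j i - signed_unit l i"
      using cong that by (simp add: cong_iff_dvd_diff)
    ultimately show ?thesis
      using dvd_imp_le_int[of "signed_unit j i - signed_unit l i" "int m"] by force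
  qed
  note eq = this
  \<comment> \<open>A nonzero index is read off from the position and sign of its nonzero
    coordinate; used below in both directions.\<close>
  have "j = l" if "j \<noteq> 0" "j \<in> {- int n..int n}"
    "\<And>i. i \<in> {1..n} \<Longrightarrow> signed_unit j i = signed_unit l i" for j l
  proof -
    have "nat \<bar>j\<bar> \<in> {1..n}" using that by auto
    from that(3)[OF this] have "nat \<bar>j\<bar> = nat \<bar>l\<bar>" "sgn j = sgn l"
      using that(1) by (auto simp: signed_unit_def sgn_if split: if_splits)
    then show "j = l" by (auto simp: sgn_if split: if_splits)
  qed
  from this[of j l] this[of l j] show ?thesis using j l eq by (metis)
qed

text \<open>The dominators of \<open>reduce m n g\<close> are the reductions of
  \<open>g - signed_unit j\<close>, which differ for different \<open>j\<close>.\<close>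

lemma tiles_if_perfect_dominating_set:
  assumes m: "m \<ge> 3" and pds: "perfect_dominating_set (Zvec m n) (cycle_power_adj m n) S"
  shows "tiles {- int n..int n} signed_unit {v. reduce m n v \<in> S}"
  unfolding tiles_def
proof
  fix g
  let ?dom = "dominates (cycle_power_adj m n)"
  define v where "v = reduce m n g"
  have v: "v \<in> Zvec m n" using m by (simp add: v_def reduce_in_Zvec)
  have SZ: "S \<subseteq> Zvec m n"
    using pds by (simp add: perfect_dominating_set_def dominating_set_def)
  obtain u where u: "u \<in> S" "?dom u v" and uniq: "\<And>w. w \<in> S \<Longrightarrow> ?dom w v \<Longrightarrow> w = u"
    using pds v unfolding perfect_dominating_set_def by metis
  have red: "reduce m n (g - signed_unit j) = w \<longleftrightarrow>
      (\<forall>i\<in>{1..n}. [w i - v i = - signed_unit j i] (mod int m))"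
    if "w \<in> Zvec m n" for w j
  proof -
    have "reduce m n (g - signed_unit j) = w \<longleftrightarrow>
        (\<forall>i\<in>{1..n}. [g i - signed_unit j i = w i] (mod int m))"
      using reduce_eq_iff[of m n "g - signed_unit j" w] reduce_Zvec[OF that] by simp
    also have "\<dots> \<longleftrightarrow> (\<forall>i\<in>{1..n}. [w i - v i = - signed_unit j i] (mod int m))"
    proof (rule ball_cong[OF refl])
      fix i assume "i \<in> {1..n}"
      then have "[v i = g i] (mod int m)" by (simp add: v_def reduce_def cong_def)
      then have "[w i - v i = - signed_unit j i] (mod int m) \<longleftrightarrow>
          [w i - g i = - signed_unit j i] (mod int m)"
        by (meson cong_diff cong_refl cong_sym cong_trans)
      also have "\<dots> \<longleftrightarrow> [w i = g i - signed_unit j i] (mod int m)"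
        by (simp add: cong_iff_dvd_diff algebra_simps)
      finally show "[g i - signed_unit j i = w i] (mod int m) \<longleftrightarrow>
          [w i - v i = - signed_unit j i] (mod int m)"
        by (simp add: cong_sym_eq)
    qed
    finally show ?thesis .
  qed
  have dom_iff: "?dom w v \<longleftrightarrow> (\<exists>j\<in>{- int n..int n}. reduce m n (g - signed_unit j) = w)"
    if w: "w \<in> Zvec m n" for w
  proof
    assume "?dom w v"
    then consider "w = v"
      | i where "i \<in> {1..n}" "\<forall>k\<in>{1..n}. [w k - v k = unit_vector i k] (mod int m)"
      | i where "i \<in> {1..n}" "\<forall>k\<in>{1..n}. [w k - v k = - unit_vector i k] (mod int m)"
      unfolding dominates_def cycle_power_adj_def by blast
    then show "\<exists>j\<in>{- int n..int n}. reduce m n (g - signed_unit j) = w"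
    proof cases
      case 1
      then show ?thesis by (intro bexI[of _ 0]) (auto simp: v_def signed_unit_simps)
    next
      case (2 i)
      \<comment> \<open>\<open>red\<close> equates \<open>w - v\<close> with minus the signed unit,
        hence the opposite sign of the index.\<close>
      then show ?thesis
        unfolding red[OF w] by (intro bexI[of _ "- int i"]) (auto simp: signed_unit_simps)
    next
      case (3 i)
      then show ?thesis
        unfolding red[OF w] by (intro bexI[of _ "int i"]) (auto simp: signed_unit_simps)
    qed
  next
    assume "\<exists>j\<in>{- int n..int n}. reduce m n (g - signed_unit j) = w"
    then obtain j where j: "j \<in> {- int n..int n}"
      "\<forall>i\<in>{1..n}. [w i - v i = - signed_unit j i] (mod int m)"
      "reduce m n (g - signed_unit j) = w"
      using red[OF w] by blast
    from j(1) show "?dom w v"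
    proof (cases rule: signed_unit_cases)
      case 1
      then show ?thesis using j(3) by (simp add: signed_unit_simps v_def dominates_def)
    next
      case (2 i)
      then show ?thesis using j(2)
        by (auto simp: signed_unit_simps dominates_def cycle_power_adj_def)
    next
      case (3 i)
      then show ?thesis using j(2)
        by (auto simp: signed_unit_simps dominates_def cycle_power_adj_def)
    qed
  qed
  obtain j where j: "j \<in> {- int n..int n}" "reduce m n (g - signed_unit j) = u"
    using dom_iff u SZ by blast
  show "\<exists>!j. j \<in> {- int n..int n} \<and> g - signed_unit j \<in> {v. reduce m n v \<in> S}"
  proof (rule ex1I[of _ j])
    show "j \<in> {- int n..int n} \<and> g - signed_unit j \<in> {v. reduce m n v \<in> S}"
      using j u by simp
    fix l assume l: "l \<in> {- int n..int n} \<and> g - signed_unit l \<in> {v. reduce m n v \<in> S}"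
    then have "?dom (reduce m n (g - signed_unit l)) v" using dom_iff SZ by blast
    then have "reduce m n (g - signed_unit l) = reduce m n (g - signed_unit j)"
      using uniq l j by simp
    then have "\<forall>i\<in>{1..n}. [signed_unit l i = signed_unit j i] (mod int m)"
      unfolding reduce_eq_iff by (simp add: cong_iff_dvd_diff dvd_diff_commute)
    then show "l = j" using signed_unit_cong_imp_eq[OF m, of l n j] l j by blast
  qed
qed

section \<open>Points of S on a coordinate line\<close>

theorem theorem1:
  fixes n :: nat and S :: "(nat \<Rightarrow> int) set"
  assumes "n \<ge> 1"
    and "prime (2 * n + 1)"
    and "perfect_dominating_set (Zvec (2 * n + 1) n) (cycle_power_adj (2 * n + 1) n) S"
  shows "\<forall>x \<in> Zvec (2 * n + 1) n. \<forall>i \<in> {1..n}.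
    card (S \<inter> {y \<in> Zvec (2 * n + 1) n. \<forall>j \<in> {1..n}. j \<noteq> i \<longrightarrow> y j = x j}) = 1"
proof (intro ballI)
  fix x i assume x: "x \<in> Zvec (2 * n + 1) n" and i: "i \<in> {1..n}"
  define m where "m = 2 * n + 1"
  note x = x[folded m_def]
  let ?J = "{- int n..int n}"
  have m: "m \<ge> 3" "m > 0" using assms(1) by (simp_all add: m_def)
  have SZ: "S \<subseteq> Zvec m n"
    using assms(3) by (simp add: perfect_dominating_set_def dominating_set_def m_def)
  have cardJ: "card ?J = m" by (simp add: m_def)
  interpret constant_density "Zvec m n" "{v. reduce m n v \<in> S}" "card S"
    by (rule constant_density_Zvec[OF m(2) SZ])
  have "tiles {..<card ?J} (\<lambda>k. of_nat k * signed_unit (int i)) {v. reduce m n v \<in> S}"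
  proof (rule tiles_line[where z = 0])
    show "tiles ?J signed_unit {v. reduce m n v \<in> S}"
      using tiles_if_perfect_dominating_set[OF m(1)] assms(3) by (simp add: m_def)
    show "prime (card ?J)" using assms(2) unfolding cardJ m_def .
  qed (use i in \<open>auto simp: signed_unit_simps\<close>)
  \<comment> \<open>The line tiling evaluated at \<open>g = x\<close>.\<close>
  then have card1: "card {k \<in> {..<m}. reduce m n (x - of_nat k * unit_vector i) \<in> S} = 1"
    using i unfolding tiles_iff_card cardJ by (simp add: signed_unit_simps)
  let ?f = "\<lambda>k. reduce m n (x - of_nat k * unit_vector i)"
  let ?L = "S \<inter> {y \<in> Zvec m n. \<forall>j \<in> {1..n}. j \<noteq> i \<longrightarrow> y j = x j}"
  have fj: "?f k j = x j" if "j \<in> {1..n}" "j \<noteq> i" for k j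
    using that x by (auto simp: reduce_def unit_vector_def Zvec_def PiE_iff)
  have fi: "?f k i = (x i - int k) mod int m" for k
    using i by (simp add: reduce_def unit_vector_def)
  \<comment> \<open>\<open>k\<close> parametrises the line through \<open>x\<close> in direction
    \<open>i\<close>, which transfers the count.\<close>
  have bij: "bij_betw ?f {k \<in> {..<m}. ?f k \<in> S} ?L"
    unfolding bij_betw_def
  proof
    show "inj_on ?f {k \<in> {..<m}. ?f k \<in> S}"
    proof (rule inj_onI)
      fix k l assume kl: "k \<in> {k \<in> {..<m}. ?f k \<in> S}" "l \<in> {k \<in> {..<m}. ?f k \<in> S}" "?f k = ?f l"
      then have "[x i - int k = x i - int l] (mod int m)"
        using fi[of k] fi[of l] by (simp add: cong_def)
      then have "[int k = int l] (mod int m)"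
        by (simp add: cong_iff_dvd_diff dvd_diff_commute)
      then show "k = l" using kl by (simp add: cong_int_iff cong_def)
    qed
    show "?f ` {k \<in> {..<m}. ?f k \<in> S} = ?L"
    proof
      show "?f ` {k \<in> {..<m}. ?f k \<in> S} \<subseteq> ?L"
        using fj reduce_in_Zvec[OF m(2)] by blast
      show "?L \<subseteq> ?f ` {k \<in> {..<m}. ?f k \<in> S}"
      proof
        fix y assume y: "y \<in> ?L"
        \<comment> \<open>The solution of \<open>x i - k = y i\<close> modulo
          \<open>m\<close>.\<close>
        define k where "k = nat ((x i - y i) mod int m)"
        have k: "int k = (x i - y i) mod int m" "k < m"
          using m by (simp_all add: k_def nat_less_iff)
        have "?f k i = y i mod int m" unfolding fi k by (simp add: mod_simps)
        also have "\<dots> = y i" using y i by (auto simp: Zvec_def PiE_iff)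
        finally have "?f k j = y j" if "j \<in> {1..n}" for j using that fj y by (cases "j = i") auto
        moreover have "?f k \<in> {1..n} \<rightarrow>\<^sub>E {0..<int m}" "y \<in> {1..n} \<rightarrow>\<^sub>E {0..<int m}"
          using reduce_in_Zvec[OF m(2)] y unfolding Zvec_def by blast+
        ultimately have "?f k = y" by (metis PiE_ext)
        then show "y \<in> ?f ` {k \<in> {..<m}. ?f k \<in> S}" using k y by blast
      qed
    qed
  qed
  show "card (S \<inter> {y \<in> Zvec (2 * n + 1) n. \<forall>j \<in> {1..n}. j \<noteq> i \<longrightarrow> y j = x j}) = 1"
    using bij_betw_same_card[OF bij] card1 unfolding m_def by simp
qed

end
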